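(* There is an absolute constant $C$ such that for all $n$ and $W$, $$\mathrm{vfg}(n,W)\le\max\{\mathrm{efg}(n',W) : n'\le Cn\}.$$
   Context: For a directed graph $G=(V,E)$ with nonnegative edge weights $w$, $\mathrm{dist}_w(s,t)$ is the minimum total edge weight of an $s\leadsto t$ path. $\mathrm{efg}(n,W)$ is the least integer such that for every $n$-node directed graph with nonnegative edge costs $\mathrm{cost}$ and nonnegative edge weights $w$ with $w(E)=W$, there is $X\subseteq E$ such that every $s\leadsto t$ path contains an edge of $X$ whenever $\mathrm{dist}_w(s,t)\ge1$, and $\mathrm{cost}(X)\le\langle\mathrm{cost},w\rangle\cdot\mathrm{efg}(n,W)$, where $\mathrm{cost}(X)=\sum_{e\in X}\mathrm{cost}(e)$ and $\langle\mathrm{cost},w\rangle=\sum_e\mathrm{cost}(e)w(e)$. For vertex weights $w$, $\mathrm{vdist}_w(s,t)$ is the minimum over $s\leadsto t$ paths of the total weight of interior vertices (excluding $s,t$). $\mathrm{vfg}(n,W)$ is the least integer such that for every $n$-node directed graph with nonnegative vertex costs and nonnegative vertex weights $w$ with $w(V)=W$, there is $X\subseteq V$ such that every $s\leadsto t$ path contains an internal node in $X$ whenever $\mathrm{vdist}_w(s,t)\ge1$, and $\mathrm{cost}(X)\le\langle\mathrm{cost},w\rangle\cdot\mathrm{vfg}(n,W)$. *)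

theory Defs
  imports "HOL-Analysis.Analysis" "Graph_Theory.Graph_Theory"
begin

text \<open>
  A directed graph \<open>(V, E)\<close> is a \<open>pair_digraph\<close>: finite vertex set, \<open>E \<subseteq> V \<times> V\<close>, no loops.
  A path is an \<open>apath\<close> (no repeated vertices; for \<open>s = t\<close> only the trivial path).
  The edge distance is the library's \<open>wf_digraph.\<mu>\<close>, an infimum over all walks; for nonnegative
  weights this is the minimum over paths, and it is \<open>\<infinity>\<close> if \<open>t\<close> is not reachable from \<open>s\<close>.
\<close>

definition vdist :: "'a pair_pre_digraph \<Rightarrow> ('a \<Rightarrow> real) \<Rightarrow> 'a \<Rightarrow> 'a \<Rightarrow> ereal" where
  "vdist G w s t =
     (INF p \<in> {p. pre_digraph.apath (with_proj G) s p t}.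
        ereal (\<Sum>v\<leftarrow>pre_digraph.inner_verts (with_proj G) p. w v))"

definition edge_cut :: "'a pair_pre_digraph \<Rightarrow> ('a \<times> 'a \<Rightarrow> real) \<Rightarrow> ('a \<times> 'a) set \<Rightarrow> bool" where
  "edge_cut G w X \<longleftrightarrow> X \<subseteq> parcs G \<and>
     (\<forall>s \<in> pverts G. \<forall>t \<in> pverts G. wf_digraph.\<mu> (with_proj G) w s t \<ge> 1 \<longrightarrow>
        (\<forall>p. pre_digraph.apath (with_proj G) s p t \<longrightarrow> set p \<inter> X \<noteq> {}))"

definition vertex_cut :: "'a pair_pre_digraph \<Rightarrow> ('a \<Rightarrow> real) \<Rightarrow> 'a set \<Rightarrow> bool" where
  "vertex_cut G w X \<longleftrightarrow> X \<subseteq> pverts G \<and>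
     (\<forall>s \<in> pverts G. \<forall>t \<in> pverts G. vdist G w s t \<ge> 1 \<longrightarrow>
        (\<forall>p. pre_digraph.apath (with_proj G) s p t \<longrightarrow>
           set (pre_digraph.inner_verts (with_proj G) p) \<inter> X \<noteq> {}))"

text \<open>
  Every finite graph is isomorphic to one on natural numbers, so quantifying over graphs with
  vertices in \<open>nat\<close> covers all \<open>n\<close>-node graphs.
\<close>

definition edge_gap_bound :: "nat \<Rightarrow> real \<Rightarrow> nat \<Rightarrow> bool" where
  "edge_gap_bound n W k \<longleftrightarrow>
     (\<forall>(G :: nat pair_pre_digraph) cost w.
        pair_digraph G \<and> card (pverts G) = n \<and>
        (\<forall>e \<in> parcs G. 0 \<le> cost e) \<and> (\<forall>e \<in> parcs G. 0 \<le> w e) \<and>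
        (\<Sum>e \<in> parcs G. w e) = W \<longrightarrow>
        (\<exists>X. edge_cut G w X \<and>
           (\<Sum>e \<in> X. cost e) \<le> (\<Sum>e \<in> parcs G. cost e * w e) * real k))"

definition vertex_gap_bound :: "nat \<Rightarrow> real \<Rightarrow> nat \<Rightarrow> bool" where
  "vertex_gap_bound n W k \<longleftrightarrow>
     (\<forall>(G :: nat pair_pre_digraph) cost w.
        pair_digraph G \<and> card (pverts G) = n \<and>
        (\<forall>v \<in> pverts G. 0 \<le> cost v) \<and> (\<forall>v \<in> pverts G. 0 \<le> w v) \<and>
        (\<Sum>v \<in> pverts G. w v) = W \<longrightarrow>
        (\<exists>X. vertex_cut G w X \<and>
           (\<Sum>v \<in> X. cost v) \<le> (\<Sum>v \<in> pverts G. cost v * w v) * real k))"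

text \<open>
  The least integer is taken among the naturals: a negative integer can only be a valid bound in
  degenerate cases (such as \<open>W = 0\<close> or no edges at all), where every integer is a valid bound and
  a least one would not exist.
\<close>

definition efg :: "nat \<Rightarrow> real \<Rightarrow> nat" where
  "efg n W = (LEAST k. edge_gap_bound n W k)"

definition vfg :: "nat \<Rightarrow> real \<Rightarrow> nat" where
  "vfg n W = (LEAST k. vertex_gap_bound n W k)"

end

theory Submission
  imports Defs
begin

text \<open>
  Split every vertex \<open>v\<close> into an arc from \<open>2 * v\<close> to \<open>Suc (2 * v)\<close> that inherits the weight and
  cost of \<open>v\<close>, and give the original arcs weight \<open>0\<close> and a cost so large that no cheap edge cut
  can use them. The edge distance from \<open>Suc (2 * s)\<close> to \<open>2 * t\<close> in the split graph is at least the
  vertex distance from \<open>s\<close> to \<open>t\<close>, so a cheap edge cut of the split graph yields a cheap vertex cut.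
  Hence \<open>C = 2\<close> works. Picking all edges of weight at least \<open>1 / n\<close> shows that
  \<open>efg n W\<close> is a minimum over a nonempty set.
\<close>

section \<open>Existence of an edge gap bound\<close>

text \<open>Pigeonhole: at most \<open>n\<close> arcs that all weigh less than 1/n have total weight
  below 1. The product form of the conclusion avoids dividing by \<open>n = 0\<close>.\<close>

lemma (in wf_digraph) awalk_weight_ge_one:
  assumes "awalk s p t" and "\<mu> w s t \<ge> 1" and "length p \<le> n"
  shows "\<exists>e \<in> set p. w e * real n \<ge> 1"
proof (rule ccontr)
  assume "\<not> ?thesis"
  then have small: "w e * real n < 1" if "e \<in> set p" for e
    using that by force
  have "1 \<le> ereal (awalk_cost w p)"
    using assms(2) min_cost_le_walk_cost[OF assms(1)] by (rule order_trans)
  then have cost: "1 \<le> awalk_cost w p"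
    by simp
  then have "p \<noteq> []"
    by auto
  with assms(3) have "n > 0"
    by (cases p) auto
  have "awalk_cost w p < (\<Sum>e\<leftarrow>p. 1 / real n)"
    unfolding awalk_cost_def using \<open>p \<noteq> []\<close> small \<open>n > 0\<close>
    by (intro sum_list_strict_mono) (simp_all add: pos_less_divide_eq)
  also have "\<dots> \<le> 1"
    using assms(3) \<open>n > 0\<close> by (simp add: sum_list_triv)
  finally show False
    using cost by simp
qed

lemma edge_gap_bound_card: "edge_gap_bound n W n"
  unfolding edge_gap_bound_def
proof (intro allI impI, elim conjE)
  fix G :: "nat pair_pre_digraph" and cost w :: "nat \<times> nat \<Rightarrow> real"
  assume "pair_digraph G" and card: "card (pverts G) = n"
    and cost: "\<forall>e \<in> parcs G. 0 \<le> cost e" and w: "\<forall>e \<in> parcs G. 0 \<le> w e"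
  interpret pair_digraph G by fact
  let ?X = "{e \<in> parcs G. w e * real n \<ge> 1}"
  have "edge_cut G w ?X"
    unfolding edge_cut_def
  proof (intro conjI ballI allI impI)
    fix s t p
    assume "wf_digraph.\<mu> (with_proj G) w s t \<ge> 1" and "pre_digraph.apath (with_proj G) s p t"
    \<comment> \<open>An \<open>apath\<close> repeats no vertex, so its length is at most the number
      of vertices \<open>n\<close>.\<close>
    then have "\<exists>e \<in> set p. w e * real n \<ge> 1"
      using awalk_weight_ge_one[of s p t w n] length_apath[of s p t] card
      by (simp add: apath_def)
    moreover have "set p \<subseteq> parcs G"
      using \<open>apath s p t\<close> by (simp add: apath_def awalk_def)
    ultimately show "set p \<inter> ?X \<noteq> {}"
      by blast
  qed auto
  moreover have "(\<Sum>e \<in> ?X. cost e) \<le> (\<Sum>e \<in> parcs G. cost e * w e) * real n"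
  proof -
    have "(\<Sum>e \<in> ?X. cost e) \<le> (\<Sum>e \<in> ?X. cost e * w e * real n)"
    proof (rule sum_mono)
      fix e assume "e \<in> ?X"
      then show "cost e \<le> cost e * w e * real n"
        using cost mult_left_mono[of 1 "w e * real n" "cost e"] by (simp add: mult.assoc)
    qed
    also have "\<dots> \<le> (\<Sum>e \<in> parcs G. cost e * w e * real n)"
      using cost w by (intro sum_mono2) (auto simp: pair_finite_arcs)
    finally show ?thesis
      by (simp add: sum_distrib_right)
  qed
  ultimately show "\<exists>X. edge_cut G w X \<and>
      (\<Sum>e \<in> X. cost e) \<le> (\<Sum>e \<in> parcs G. cost e * w e) * real n"
    by blast
qed

lemma edge_gap_bound_efg: "edge_gap_bound n W (efg n W)"
  unfolding efg_def by (rule LeastI) (rule edge_gap_bound_card)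

section \<open>The split graph\<close>

definition split_graph :: "nat pair_pre_digraph \<Rightarrow> nat pair_pre_digraph" where
  "split_graph G = \<lparr>pverts = (\<lambda>v. 2 * v) ` pverts G \<union> (\<lambda>v. Suc (2 * v)) ` pverts G,
     parcs = (\<lambda>v. (2 * v, Suc (2 * v))) ` pverts G \<union> (\<lambda>(u, v). (Suc (2 * u), 2 * v)) ` parcs G\<rparr>"

text \<open>In the split graph the arcs with even tail are exactly those that come from vertices.\<close>

definition split_fun :: "(nat \<Rightarrow> real) \<Rightarrow> real \<Rightarrow> nat \<times> nat \<Rightarrow> real" where
  "split_fun f c e = (if even (fst e) then f (fst e div 2) else c)"

lemma split_fun_simps [simp]:
  "split_fun f c (2 * v, u) = f v" "split_fun f c (Suc (2 * v), u) = c"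
  by (simp_all add: split_fun_def)

lemma split_graph_arc_iff:
  "(2 * u, x) \<in> parcs (split_graph G) \<longleftrightarrow> u \<in> pverts G \<and> x = Suc (2 * u)"
  "(Suc (2 * u), x) \<in> parcs (split_graph G) \<longleftrightarrow> (\<exists>v. (u, v) \<in> parcs G \<and> x = 2 * v)"
  by (auto simp: split_graph_def image_iff split: prod.splits) presburger+

lemma split_graph_vert_iff:
  "2 * u \<in> pverts (split_graph G) \<longleftrightarrow> u \<in> pverts G"
  "Suc (2 * u) \<in> pverts (split_graph G) \<longleftrightarrow> u \<in> pverts G"
  by (auto simp: split_graph_def image_iff) presburger+

lemma pair_digraph_split_graph:
  assumes "pair_digraph G"
  shows "pair_digraph (split_graph G)"
proof -
  interpret pair_digraph G by fact
  show ?thesis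
  proof
    show "fst e \<noteq> snd e" if "e \<in> parcs (split_graph G)" for e
      using that by (auto simp: split_graph_def) presburger+
  qed (auto simp: split_graph_def pair_finite_verts pair_finite_arcs dest: wellformed')
qed

lemma card_split_graph:
  assumes "pair_digraph G"
  shows "card (pverts (split_graph G)) = 2 * card (pverts G)"
proof -
  interpret pair_digraph G by fact
  have "(\<lambda>v. 2 * v) ` pverts G \<inter> (\<lambda>v. Suc (2 * v)) ` pverts G = {}"
    by auto presburger
  then show ?thesis
    by (simp add: split_graph_def card_Un_disjoint pair_finite_verts card_image inj_on_def)
qed

text \<open>Applied to the weight and to cost times weight: both vanish on the original arcs, so
  total weight and the product of cost and weight carry over from \<open>G\<close>, however large
  the cost of these arcs.\<close>

lemma sum_split_graph:
  fixes g :: "nat \<times> nat \<Rightarrow> real"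
  assumes "pair_digraph G" and "\<And>u v. (u, v) \<in> parcs G \<Longrightarrow> g (Suc (2 * u), 2 * v) = 0"
  shows "(\<Sum>e \<in> parcs (split_graph G). g e) = (\<Sum>v \<in> pverts G. g (2 * v, Suc (2 * v)))"
proof -
  interpret pair_digraph G by fact
  have "(\<Sum>e \<in> parcs (split_graph G). g e) = (\<Sum>e \<in> (\<lambda>v. (2 * v, Suc (2 * v))) ` pverts G. g e)"
    using assms(2)
    by (intro sum.mono_neutral_right)
      (auto simp: split_graph_def pair_finite_verts pair_finite_arcs)
  also have "\<dots> = (\<Sum>v \<in> pverts G. g (2 * v, Suc (2 * v)))"
    by (subst sum.reindex) (auto simp: inj_on_def)
  finally show ?thesis .
qed

section \<open>Walks in the graph and in the split graph\<close>

text \<open>Between consecutive arcs of \<open>p\<close> the arc of the vertex they share is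
  inserted. Leaving \<open>u\<close> on its odd side and reaching \<open>v\<close> on its even side
  omits the vertex arcs of the two ends, in accordance with counting interior vertices only.\<close>

lemma split_graph_lift_awalk:
  assumes "pair_digraph G" and "pre_digraph.awalk (with_proj G) u p v" and "p \<noteq> []"
  shows "\<exists>q. pre_digraph.awalk (with_proj (split_graph G)) (Suc (2 * u)) q (2 * v) \<and>
    (\<forall>e \<in> set q. even (fst e) \<longrightarrow> fst e div 2 \<in> set (pre_digraph.inner_verts (with_proj G) p))"
  using assms(2,3)
proof (induction p arbitrary: u)
  case (Cons e p)
  interpret G: pair_digraph G by fact
  interpret H: pair_digraph "split_graph G"
    using assms(1) by (rule pair_digraph_split_graph)
  obtain y where e: "e = (u, y)" "(u, y) \<in> parcs G" and y: "G.awalk y p v"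
    using Cons.prems(1) by (cases e) (auto simp: G.awalk_Cons_iff)
  then have arc: "(Suc (2 * u), 2 * y) \<in> parcs (split_graph G)" and "y \<in> pverts G"
    by (auto simp: split_graph_arc_iff dest: G.wellformed')
  show ?case
  proof (cases "p = []")
    case True
    then have "y = v"
      using y by (simp add: G.awalk_Nil_iff)
    have "H.awalk (Suc (2 * u)) [(Suc (2 * u), 2 * v)] (2 * v)"
      using arc \<open>y = v\<close> \<open>y \<in> pverts G\<close>
      by (simp add: H.awalk_simps split_graph_vert_iff)
    then show ?thesis
      by (intro exI[of _ "[(Suc (2 * u), 2 * v)]"]) simp
  next
    case False
    then obtain q where q: "H.awalk (Suc (2 * y)) q (2 * v)"
      and inner: "\<forall>e \<in> set q. even (fst e) \<longrightarrow> fst e div 2 \<in> set (G.inner_verts p)"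
      using Cons.IH[OF y] by auto
    have "H.awalk (Suc (2 * u)) ((Suc (2 * u), 2 * y) # (2 * y, Suc (2 * y)) # q) (2 * v)"
      using arc q \<open>y \<in> pverts G\<close> split_graph_arc_iff(1)[of y "Suc (2 * y)" G]
      by (simp add: H.awalk_Cons_iff)
    moreover have "G.inner_verts (e # p) = y # G.inner_verts p"
      using False G.inner_verts_Cons[OF Cons.prems(1)] e by simp
    ultimately show ?thesis
      using inner by (intro exI[of _ "(Suc (2 * u), 2 * y) # (2 * y, Suc (2 * y)) # q"]) auto
  qed
qed simp

text \<open>The infimum \<open>\<mu>\<close> ranges over all walks, so \<open>q\<close> may revisit
  vertices. The induction removes an original arc and the vertex arc after it, and any repetition of
  \<open>x\<close> is cut out, which cannot raise the weight.\<close>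

lemma split_graph_project_awalk:
  assumes "pair_digraph G" and w: "\<forall>v \<in> pverts G. 0 \<le> w v" and "x \<noteq> t"
    and "pre_digraph.awalk (with_proj (split_graph G)) (Suc (2 * x)) q (2 * t)"
  shows "\<exists>p. pre_digraph.apath (with_proj G) x p t \<and>
    (\<Sum>v\<leftarrow>pre_digraph.inner_verts (with_proj G) p. w v)
      \<le> wf_digraph.awalk_cost (split_fun w 0) q"
  using assms(3,4)
proof (induction q arbitrary: x rule: length_induct)
  case (1 q)
  interpret G: pair_digraph G by fact
  interpret H: pair_digraph "split_graph G"
    using assms(1) by (rule pair_digraph_split_graph)
  \<comment> \<open>The ends differ in parity, so \<open>q\<close> is not empty.\<close>
  have "Suc (2 * x) \<noteq> 2 * t"
    by presburger
  with 1(3) obtain y q1 where q: "q = (Suc (2 * x), 2 * y) # q1" and xy: "(x, y) \<in> parcs G"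
    and q1: "H.awalk (2 * y) q1 (2 * t)"
    by (cases q) (auto simp: H.awalk_simps split_graph_arc_iff)
  have "x \<noteq> y" and "y \<in> pverts G"
    using xy G.no_loops' G.wellformed' by auto
  have xyp: "G.apath x [(x, y)] y"
    using xy \<open>x \<noteq> y\<close> \<open>y \<in> pverts G\<close> by (simp add: G.apath_simps)
  show ?case
  proof (cases "y = t")
    case True
    \<comment> \<open>The walk may leave \<open>2 * t\<close> and return, so \<open>q1\<close> can
      be nonempty. The single arc has no inner vertex, hence weight 0.\<close>
    have "H.awalk_cost (split_fun w 0) q1 \<ge> 0"
      using q1 by (rule H.pos_cost_pos_awalk_cost)
        (use w in \<open>auto simp: split_graph_def\<close>)
    then show ?thesis
      using xyp True by (intro exI[of _ "[(x, y)]"]) (simp add: q)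
  next
    case False
    then obtain q2 where q2: "q1 = (2 * y, Suc (2 * y)) # q2" "H.awalk (Suc (2 * y)) q2 (2 * t)"
      using q1 by (cases q1) (auto simp: H.awalk_simps split_graph_arc_iff(1))
    then obtain p where p: "G.apath y p t"
      and le: "(\<Sum>v\<leftarrow>G.inner_verts p. w v) \<le> H.awalk_cost (split_fun w 0) q2"
      using 1(1)[rule_format, of q2 y] False q by auto
    have "p \<noteq> []"
      using p False by (auto simp: G.apath_Nil_iff)
    \<comment> \<open>The tails of \<open>p\<close> are exactly the vertices that become interior
      once \<open>(x, y)\<close> is prepended; the vertex arc of \<open>y\<close> in
      \<open>q\<close> pays for \<open>w y\<close>.\<close>
    then have fst_p: "map fst p = y # G.inner_verts p"
      using p by (cases p) (auto simp: G.inner_verts_def G.apath_Cons_iff)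
    have cost: "H.awalk_cost (split_fun w 0) q = w y + H.awalk_cost (split_fun w 0) q2"
      by (simp add: q q2)
    show ?thesis
    proof (cases "x \<in> set (pawalk_verts y p)")
      case notin: False
      have "G.apath x ((x, y) # p) t"
        using p xy notin by (simp add: G.apath_Cons_iff)
      moreover have "G.inner_verts ((x, y) # p) = map fst p"
        by (simp add: G.inner_verts_def)
      ultimately show ?thesis
        using le cost fst_p by (intro exI[of _ "(x, y) # p"]) simp
    next
      \<comment> \<open>Prepending \<open>(x, y)\<close> would repeat \<open>x\<close>, so the part
        of \<open>p\<close> from \<open>x\<close> onwards serves instead.\<close>
      case True
      then obtain p1 p2 where dec: "p = p1 @ p2" "G.awalk y p1 x" "G.awalk x p2 t"
        using G.awalk_decomp[of y p t x] p by (auto simp: G.apath_def)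
      have "G.apath x p2 t"
        using p dec(1) G.apath_append_iff[of y p1 p2 t] G.awlast_of_awalk[OF dec(2)] by simp
      have "p1 \<noteq> []"
        using dec(2) \<open>x \<noteq> y\<close> by (auto simp: G.awalk_Nil_iff)
      have "(\<Sum>v\<leftarrow>G.inner_verts p2. w v) \<le> (\<Sum>v\<leftarrow>map fst p. w v)"
      proof -
        have pos: "0 \<le> w v" if "v \<in> set (map fst p)" for v
          using that p w by (fastforce simp: G.apath_def G.awalk_def dest: G.arc_fst_in_verts)
        \<comment> \<open>The inner vertices of \<open>p2\<close> form a suffix of the tails of
          \<open>p\<close>; \<open>take 1\<close> also covers an empty \<open>p2\<close>.\<close>
        have "map fst p = map fst p1 @ take 1 (map fst p2) @ G.inner_verts p2"
          by (cases p2) (simp_all add: dec G.inner_verts_def)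
        moreover have "0 \<le> (\<Sum>v\<leftarrow>map fst p1 @ take 1 (map fst p2). w v)"
          using pos calculation by (intro sum_list_nonneg) auto
        ultimately show ?thesis
          by simp
      qed
      then show ?thesis
        using \<open>G.apath x p2 t\<close> le cost fst_p by (intro exI[of _ p2]) simp
    qed
  qed
qed

lemma vdist_le_split_graph:
  assumes "pair_digraph G" and "\<forall>v \<in> pverts G. 0 \<le> w v" and "s \<noteq> t"
  shows "vdist G w s t
    \<le> wf_digraph.\<mu> (with_proj (split_graph G)) (split_fun w 0) (Suc (2 * s)) (2 * t)"
proof -
  interpret H: pair_digraph "split_graph G"
    using assms(1) by (rule pair_digraph_split_graph)
  show ?thesis
    unfolding vdist_def H.\<mu>_def
    by (rule INF_mono) (use split_graph_project_awalk[OF assms] in \<open>simp; blast\<close>)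
qed

section \<open>From edge cuts to vertex cuts\<close>

lemma vertex_cut_split_graph:
  assumes "pair_digraph G" and w: "\<forall>v \<in> pverts G. 0 \<le> w v"
    and cut: "edge_cut (split_graph G) (split_fun w 0) X"
    and X: "X \<subseteq> (\<lambda>v. (2 * v, Suc (2 * v))) ` pverts G"
  shows "vertex_cut G w {v \<in> pverts G. (2 * v, Suc (2 * v)) \<in> X}"
  unfolding vertex_cut_def
proof (intro conjI ballI allI impI)
  interpret G: pair_digraph G by fact
  interpret H: pair_digraph "split_graph G"
    using assms(1) by (rule pair_digraph_split_graph)
  fix s t p
  assume "s \<in> pverts G" "t \<in> pverts G" and dist: "vdist G w s t \<ge> 1" and p: "G.apath s p t"
  \<comment> \<open>The trivial path has interior weight 0, which would contradict
    \<open>dist\<close>.\<close>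
  have "p \<noteq> []"
  proof
    assume "p = []"
    then have "vdist G w s t \<le> ereal 0"
      unfolding vdist_def using p by (intro INF_lower2[of "[]"]) auto
    with dist have "(1::ereal) \<le> ereal 0"
      by (rule order_trans)
    then show False
      by (simp add: one_ereal_def)
  qed
  then have "s \<noteq> t"
    using G.apath_nonempty_ends[OF p] by simp
  obtain q where q: "H.awalk (Suc (2 * s)) q (2 * t)"
    and inner: "\<forall>e \<in> set q. even (fst e) \<longrightarrow> fst e div 2 \<in> set (G.inner_verts p)"
    using split_graph_lift_awalk[OF assms(1) _ \<open>p \<noteq> []\<close>, of s t] p unfolding G.apath_def by blast
  have "1 \<le> H.\<mu> (split_fun w 0) (Suc (2 * s)) (2 * t)"
    using dist vdist_le_split_graph[OF assms(1) w \<open>s \<noteq> t\<close>] by (rule order_trans)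
  \<comment> \<open>Edge cuts only concern paths, so the lifted walk is first shortened; the arc
    found in \<open>X\<close> still lies on \<open>q\<close>, hence comes from an inner vertex of
    \<open>p\<close>.\<close>
  then have "set (H.awalk_to_apath q) \<inter> X \<noteq> {}"
    using cut H.apath_awalk_to_apath[OF q] \<open>s \<in> pverts G\<close> \<open>t \<in> pverts G\<close> split_graph_vert_iff
    unfolding edge_cut_def by blast
  then obtain v where "v \<in> pverts G" "(2 * v, Suc (2 * v)) \<in> X" "(2 * v, Suc (2 * v)) \<in> set q"
    using H.awalk_to_apath_subset[OF q] X by blast
  then show "set (G.inner_verts p) \<inter> {v \<in> pverts G. (2 * v, Suc (2 * v)) \<in> X} \<noteq> {}"
    using inner by fastforce
qed auto

lemma vertex_gap_bound_if_edge_gap_bound: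
  assumes "edge_gap_bound (2 * n) W k"
  shows "vertex_gap_bound n W k"
  unfolding vertex_gap_bound_def
proof (intro allI impI, elim conjE)
  fix G :: "nat pair_pre_digraph" and cost w :: "nat \<Rightarrow> real"
  assume G: "pair_digraph G" and card: "card (pverts G) = n"
    and cost: "\<forall>v \<in> pverts G. 0 \<le> cost v" and w: "\<forall>v \<in> pverts G. 0 \<le> w v"
    and W: "(\<Sum>v \<in> pverts G. w v) = W"
  interpret G: pair_digraph G by fact
  interpret H: pair_digraph "split_graph G"
    using G by (rule pair_digraph_split_graph)
  \<comment> \<open>\<open>B\<close> is the budget of the cut. One original arc at cost
    \<open>B + 1\<close> already exceeds it, while its weight 0 keeps it from raising the
    budget.\<close>
  define B where "B = (\<Sum>v \<in> pverts G. cost v * w v) * real k"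
  let ?cost = "split_fun cost (B + 1)" and ?w = "split_fun w 0"
  have "B \<ge> 0"
    unfolding B_def using cost w by (intro mult_nonneg_nonneg sum_nonneg) auto
  then have cost': "\<forall>e \<in> parcs (split_graph G). 0 \<le> ?cost e"
    using cost by (auto simp: split_graph_def)
  have w': "\<forall>e \<in> parcs (split_graph G). 0 \<le> ?w e"
    using w by (auto simp: split_graph_def)
  have "(\<Sum>e \<in> parcs (split_graph G). ?w e) = W"
    using W by (subst sum_split_graph[OF G]) simp_all
  then obtain X where cut: "edge_cut (split_graph G) ?w X"
    and "(\<Sum>e \<in> X. ?cost e) \<le> (\<Sum>e \<in> parcs (split_graph G). ?cost e * ?w e) * real k"
    using assms[unfolded edge_gap_bound_def, rule_format, of "split_graph G" ?cost ?w]
      H.pair_digraph card_split_graph[OF G] card cost' w'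
    by blast
  moreover have "(\<Sum>e \<in> parcs (split_graph G). ?cost e * ?w e) = (\<Sum>v \<in> pverts G. cost v * w v)"
    by (subst sum_split_graph[OF G]) simp_all
  ultimately have le: "(\<Sum>e \<in> X. ?cost e) \<le> B"
    by (simp add: B_def)
  have "X \<subseteq> parcs (split_graph G)"
    using cut by (simp add: edge_cut_def)
  then have "finite X"
    using H.pair_finite_arcs finite_subset by blast
  have X: "X \<subseteq> (\<lambda>v. (2 * v, Suc (2 * v))) ` pverts G"
  proof
    fix e assume "e \<in> X"
    have "?cost e \<le> (\<Sum>e \<in> X. ?cost e)"
      using \<open>e \<in> X\<close> \<open>finite X\<close> \<open>X \<subseteq> parcs (split_graph G)\<close> cost' by (intro member_le_sum) auto
    then have "?cost e < B + 1"
      using le by simp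
    then show "e \<in> (\<lambda>v. (2 * v, Suc (2 * v))) ` pverts G"
      using \<open>e \<in> X\<close> \<open>X \<subseteq> parcs (split_graph G)\<close> by (auto simp: split_graph_def)
  qed
  let ?Y = "{v \<in> pverts G. (2 * v, Suc (2 * v)) \<in> X}"
  have "X = (\<lambda>v. (2 * v, Suc (2 * v))) ` ?Y"
    using X by blast
  then have "(\<Sum>e \<in> X. ?cost e) = (\<Sum>e \<in> (\<lambda>v. (2 * v, Suc (2 * v))) ` ?Y. ?cost e)"
    by simp
  also have "\<dots> = (\<Sum>v \<in> ?Y. cost v)"
    by (subst sum.reindex) (auto simp: inj_on_def)
  finally have "(\<Sum>v \<in> ?Y. cost v) \<le> B"
    using le by simp
  then show "\<exists>X. vertex_cut G w X \<and>
      (\<Sum>v \<in> X. cost v) \<le> (\<Sum>v \<in> pverts G. cost v * w v) * real k"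
    using vertex_cut_split_graph[OF G w cut X] unfolding B_def by blast
qed

theorem theorem9:
  shows "\<exists>C::real. C > 0 \<and>
    (\<forall>(n::nat) (W::real). vfg n W \<le> Max {efg n' W |n'. real n' \<le> C * real n})"
proof (intro exI[of _ 2] conjI allI)
  fix n :: nat and W :: real
  \<comment> \<open>As the image of a finite interval the set is finite, so \<open>Max\<close> is a
    true maximum.\<close>
  have set_eq: "{efg n' W |n'. real n' \<le> 2 * real n} = (\<lambda>n'. efg n' W) ` {..2 * n}"
    by (auto simp: image_iff)
  have "vfg n W \<le> efg (2 * n) W"
    unfolding vfg_def
    by (intro Least_le vertex_gap_bound_if_edge_gap_bound edge_gap_bound_efg)
  also have "\<dots> \<le> Max {efg n' W |n'. real n' \<le> 2 * real n}"
    unfolding set_eq by (intro Max_ge) auto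
  finally show "vfg n W \<le> Max {efg n' W |n'. real n' \<le> 2 * real n}" .
qed simp

end
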